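(* Consider the Pólya–Friedman mixed urn model with parameters $a,b,c,p$ and initial composition $(Y^1_0,Y^2_0)$, as described in the context, where $Y^1_0,Y^2_0$ are non-negative integers with $T_0:=Y^1_0+Y^2_0>0$, $a,b,c$ are positive integers and $p\in(0,1)$. Let $Z_n=Y^1_n/T_n$ be the proportion of balls of type $1$ after $n$ draws. Then for every $\varepsilon>0$ there exists a constant $\kappa>0$, independent of $n$, such that for all sufficiently large $n$, $$\mathbb{P}\left(\left|Z_{n+1}-\tfrac12\right|>\varepsilon\right)\le 2e^{-\kappa n}.$$
   Context: Pólya–Friedman mixed urn model. An urn contains balls of two types, type $1$ and type $2$. Let $Y^1_n,Y^2_n$ be the numbers of balls of type $1$ and type $2$ after $n$ draws, $T_n:=Y^1_n+Y^2_n$ the total number of balls, $Z_n:=Y^1_n/T_n$, and $\mathcal{F}_n$ the $\sigma$-algebra generated by the first $n$ steps. At each step a ball is drawn uniformly at random, its type is observed, and it is returned. Then, with probability $p$ (independently of the past and of the drawn type), the Friedman rule is applied: $a$ balls of the drawn type and $b$ balls of the opposite type are added; with probability $1-p$ the Pólya rule is applied: $c$ balls of the drawn type are added. Formally, $(\xi_n)_{n\ge1}$ are i.i.d. with $\mathbb{P}(\xi_n=1)=p$, $\mathbb{P}(\xi_n=0)=1-p$, with $\xi_{n+1}$ independent of $\mathcal{F}_n$; $\eta_{n+1}\in\{0,1\}$ satisfies $\mathbb{P}(\eta_{n+1}=1\mid\mathcal{F}_n)=Z_n$; and $\xi_{n+1},\eta_{n+1}$ are conditionally independent given $\mathcal{F}_n$.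 The increments are $$\Delta Y^1_{n+1}:=Y^1_{n+1}-Y^1_n=a\mathbf{1}_{\{\xi_{n+1}=1,\eta_{n+1}=1\}}+b\mathbf{1}_{\{\xi_{n+1}=1,\eta_{n+1}=0\}}+c\mathbf{1}_{\{\xi_{n+1}=0,\eta_{n+1}=1\}},$$ $$\Delta T_{n+1}:=T_{n+1}-T_n=(a+b)\mathbf{1}_{\{\xi_{n+1}=1\}}+c\mathbf{1}_{\{\xi_{n+1}=0\}}.$$ *)

theory Defs
  imports "HOL-Probability.Probability"
begin

definition total_balls :: "(nat \<Rightarrow> 'a \<Rightarrow> nat) \<Rightarrow> (nat \<Rightarrow> 'a \<Rightarrow> nat) \<Rightarrow> nat \<Rightarrow> 'a \<Rightarrow> nat" where
  "total_balls Y1 Y2 n \<omega> = Y1 n \<omega> + Y2 n \<omega>"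

definition proportion :: "(nat \<Rightarrow> 'a \<Rightarrow> nat) \<Rightarrow> (nat \<Rightarrow> 'a \<Rightarrow> nat) \<Rightarrow> nat \<Rightarrow> 'a \<Rightarrow> real" where
  "proportion Y1 Y2 n \<omega> = real (Y1 n \<omega>) / real (total_balls Y1 Y2 n \<omega>)"

text \<open>
  The sigma-algebra generated by the first \<open>n\<close> steps. Step \<open>i \<ge> 1\<close> is described by the pair
  \<open>(\<xi> i, \<eta> i)\<close>; the index \<open>0\<close> of \<open>\<xi>\<close> and \<open>\<eta>\<close> is never used. The initial composition is
  deterministic, so for \<open>n = 0\<close> the sigma-algebra is trivial.
\<close>

definition history ::
    "'a measure \<Rightarrow> (nat \<Rightarrow> 'a \<Rightarrow> nat) \<Rightarrow> (nat \<Rightarrow> 'a \<Rightarrow> nat) \<Rightarrow> nat \<Rightarrow> 'a measure" where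
  "history M \<xi> \<eta> n = sigma (space M)
     ({\<xi> i -` A \<inter> space M | i A. 1 \<le> i \<and> i \<le> n} \<union> {\<eta> i -` A \<inter> space M | i A. 1 \<le> i \<and> i \<le> n})"

definition cond_probability :: "'a measure \<Rightarrow> 'a measure \<Rightarrow> 'a set \<Rightarrow> 'a \<Rightarrow> real" where
  "cond_probability M F E = real_cond_exp M F (indicator E)"

text \<open>Conditional independence, given \<open>F\<close>, of two random variables with values in \<open>nat\<close>.\<close>

definition cond_indep_given ::
    "'a measure \<Rightarrow> 'a measure \<Rightarrow> ('a \<Rightarrow> nat) \<Rightarrow> ('a \<Rightarrow> nat) \<Rightarrow> bool" where
  "cond_indep_given M F X Y \<longleftrightarrow>
     (\<forall>A B. AE \<omega> in M.
        cond_probability M F {\<omega> \<in> space M. X \<omega> \<in> A \<and> Y \<omega> \<in> B} \<omega> =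
        cond_probability M F {\<omega> \<in> space M. X \<omega> \<in> A} \<omega> *
        cond_probability M F {\<omega> \<in> space M. Y \<omega> \<in> B} \<omega>)"

text \<open>
  \<open>\<xi> (Suc n) = 1\<close> means that the Friedman rule is applied at draw \<open>Suc n\<close>, and
  \<open>\<eta> (Suc n) = 1\<close> that the drawn ball is of type 1.
\<close>

locale polya_friedman_urn = prob_space M
  for M :: "'a measure"
  and a b c :: nat and p :: real and y1 y2 :: nat
  and \<xi> \<eta> Y1 Y2 :: "nat \<Rightarrow> 'a \<Rightarrow> nat" +
  assumes positive: "0 < a" "0 < b" "0 < c"
    and p_range: "0 < p" "p < 1"
    and initial_nonempty: "0 < y1 + y2"
    and xi_indep: "indep_vars (\<lambda>_. count_space UNIV) \<xi> {1..}"
    and xi_distr: "prob {\<omega> \<in> space M. \<xi> (Suc n) \<omega> = 1} = p"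
                  "prob {\<omega> \<in> space M. \<xi> (Suc n) \<omega> = 0} = 1 - p"
    and xi_indep_history:
      "indep_set (sets (vimage_algebra (space M) (\<xi> (Suc n)) (count_space UNIV)))
                 (sets (history M \<xi> \<eta> n))"
    and eta_measurable: "\<eta> (Suc n) \<in> measurable M (count_space UNIV)"
    and eta_range: "\<omega> \<in> space M \<Longrightarrow> \<eta> (Suc n) \<omega> \<in> {0, 1}"
    and eta_cond:
      "AE \<omega> in M. cond_probability M (history M \<xi> \<eta> n) {\<omega> \<in> space M. \<eta> (Suc n) \<omega> = 1} \<omega>
                  = proportion Y1 Y2 n \<omega>"
    and xi_eta_cond_indep: "cond_indep_given M (history M \<xi> \<eta> n) (\<xi> (Suc n)) (\<eta> (Suc n))"
    and initial: "\<omega> \<in> space M \<Longrightarrow> Y1 0 \<omega> = y1" "\<omega> \<in> space M \<Longrightarrow> Y2 0 \<omega> = y2"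
    and step_Y1: "\<omega> \<in> space M \<Longrightarrow> Y1 (Suc n) \<omega> = Y1 n \<omega>
          + a * of_bool (\<xi> (Suc n) \<omega> = 1 \<and> \<eta> (Suc n) \<omega> = 1)
          + b * of_bool (\<xi> (Suc n) \<omega> = 1 \<and> \<eta> (Suc n) \<omega> = 0)
          + c * of_bool (\<xi> (Suc n) \<omega> = 0 \<and> \<eta> (Suc n) \<omega> = 1)"
    and step_total: "\<omega> \<in> space M \<Longrightarrow> total_balls Y1 Y2 (Suc n) \<omega> = total_balls Y1 Y2 n \<omega>
          + (a + b) * of_bool (\<xi> (Suc n) \<omega> = 1)
          + c * of_bool (\<xi> (Suc n) \<omega> = 0)"

end

theory Submission
  imports Defs
begin

text \<open>
  Write \<open>D\<close> for the difference of the two colour counts and \<open>T\<close> for the total. Given the past, the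
  increments of \<open>D\<close> and \<open>T\<close> have means \<open>\<rho> D / T\<close> and \<open>m\<close> with \<open>\<bar>\<rho>\<bar> < m\<close>. Hence, as long as
  \<open>\<bar>D\<bar> \<le> \<delta> T\<close>, the processes \<open>\<plusminus> D - \<theta> \<delta> T\<close> have negative drift for every \<open>\<theta>\<close> with
  \<open>\<bar>\<rho>\<bar> / m < \<theta>\<close>. If \<open>\<bar>D\<bar> > \<delta> T\<close> has exponentially small probability, the exponential moments
  of \<open>\<plusminus> D - \<theta> \<delta> T\<close> (with a small enough parameter, so that the exceptional event is negligible
  against their a priori exponential growth) decay geometrically, and so \<open>\<bar>D\<bar> > \<theta> \<delta> T\<close> has
  exponentially small probability as well. As \<open>\<bar>D\<bar> \<le> T\<close> always holds, one starts from \<open>\<delta> = 1\<close>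
  and reaches any positive level after finitely many contractions by a fixed \<open>\<theta> < 1\<close>.
\<close>

section \<open>Two elementary real estimates: the exponential near zero and a forced linear
  recursion\<close>

lemma exp_le_quadratic:
  fixes x :: real
  assumes "\<bar>x\<bar> \<le> 1"
  shows "exp x \<le> 1 + x + x\<^sup>2"
proof (cases "0 \<le> x")
  case True
  then show ?thesis using exp_bound[of x] assms by auto
next
  case False
  \<comment> \<open>For negative \<open>x\<close> the product
    \<open>(1 + x + x\<^sup>2) * (1 - x)\<close> telescopes to \<open>1 - x ^ 3\<close>, which is at
    least 1; replacing \<open>1 - x\<close> by the larger \<open>exp (- x)\<close> and dividing by
    it gives the claim.\<close>
  have "1 \<le> 1 + (- x) ^ 3" using False by simp
  also have "\<dots> = (1 + x + x\<^sup>2) * (1 - x)" by algebra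
  also have "\<dots> \<le> (1 + x + x\<^sup>2) * exp (- x)"
  proof (rule mult_left_mono)
    show "1 - x \<le> exp (- x)" using exp_ge_add_one_self[of "- x"] by simp
    have "0 \<le> 1 + x" using assms by linarith
    then show "0 \<le> 1 + x + x\<^sup>2" by (simp add: add_nonneg_nonneg)
  qed
  finally show ?thesis by (simp add: exp_minus field_simps)
qed

text \<open>The forcing has the same rate \<open>r\<close> as the homogeneous recursion, so
  \<open>u n\<close> may grow like \<open>n * r ^ n\<close>. Any strictly larger rate
  \<open>R\<close> absorbs the factor \<open>n\<close>.\<close>

lemma geometric_recursion_bound:
  fixes u :: "nat \<Rightarrow> real" and r R K :: real
  assumes rec: "\<And>n. u (Suc n) \<le> r * u n + K * r ^ n"
    and r: "0 < r" "r < R" and K: "0 \<le> K"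
  obtains C where "0 \<le> C" "\<And>n. u n \<le> C * R ^ n"
proof
  \<comment> \<open>The first entry starts the induction; the second gives
    \<open>C * r + K \<le> C * R\<close>, which closes it.\<close>
  define C where "C = max (\<bar>u 0\<bar>) (K / (R - r))"
  show "0 \<le> C" by (simp add: C_def)
  have CK: "K \<le> C * (R - r)"
    using r by (simp add: C_def flip: pos_divide_le_eq)
  show "u n \<le> C * R ^ n" for n
  proof (induction n)
    case 0
    show ?case by (simp add: C_def le_max_iff_disj abs_ge_self)
  next
    case (Suc n)
    have "u (Suc n) \<le> r * (C * R ^ n) + K * R ^ n"
      using rec[of n] r K Suc by (intro order_trans[OF rec] add_mono mult_left_mono power_mono) auto
    also have "\<dots> = (C * r + K) * R ^ n" by (simp add: algebra_simps)
    also have "\<dots> \<le> (C * R) * R ^ n"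
      using r CK by (intro mult_right_mono) (auto simp: algebra_simps)
    finally show ?case by (simp add: mult.assoc)
  qed
qed

context polya_friedman_urn
begin

section \<open>The filtration and adaptedness of the ball counts\<close>

lemma xi_measurable: "1 \<le> i \<Longrightarrow> \<xi> i \<in> measurable M (count_space UNIV)"
  using xi_indep by (auto simp: indep_vars_def)

lemma space_history [simp]: "space (history M \<xi> \<eta> n) = space M"
  unfolding history_def by (auto intro!: space_measure_of)

lemma sets_history:
  "sets (history M \<xi> \<eta> n) = sigma_sets (space M)
     ({\<xi> i -` A \<inter> space M | i A. 1 \<le> i \<and> i \<le> n} \<union> {\<eta> i -` A \<inter> space M | i A. 1 \<le> i \<and> i \<le> n})"
  unfolding history_def by (auto intro!: sets_measure_of)

lemma subalgebra_history: "subalgebra M (history M \<xi> \<eta> n)"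
proof -
  have "\<eta> i \<in> measurable M (count_space UNIV)" if "1 \<le> i" for i
    using eta_measurable[of "i - 1"] that by simp
  then have "sets (history M \<xi> \<eta> n) \<subseteq> sets M"
    unfolding sets_history
    by (intro sets.sigma_sets_subset) (auto intro!: measurable_sets xi_measurable)
  then show ?thesis by (simp add: subalgebra_def)
qed

lemma history_finite_subalgebra: "finite_measure_subalgebra M (history M \<xi> \<eta> n)"
  by unfold_locales (rule subalgebra_history)

lemma subalgebra_history_Suc: "subalgebra (history M \<xi> \<eta> (Suc n)) (history M \<xi> \<eta> n)"
proof -
  have "sets (history M \<xi> \<eta> n) \<subseteq> sets (history M \<xi> \<eta> (Suc n))"
    unfolding sets_history by (rule sigma_sets_mono'[OF Un_mono]) (blast intro: le_SucI)+
  then show ?thesis by (simp add: subalgebra_def)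
qed

lemma step_measurable_history:
  "\<xi> (Suc n) \<in> measurable (history M \<xi> \<eta> (Suc n)) (count_space UNIV)"
  "\<eta> (Suc n) \<in> measurable (history M \<xi> \<eta> (Suc n)) (count_space UNIV)"
proof -
  have "\<xi> (Suc n) -` A \<inter> space M \<in> {\<xi> i -` A \<inter> space M | i A. 1 \<le> i \<and> i \<le> Suc n}"
    "\<eta> (Suc n) -` A \<inter> space M \<in> {\<eta> i -` A \<inter> space M | i A. 1 \<le> i \<and> i \<le> Suc n}" for A
    by (rule CollectI, rule exI[of _ "Suc n"], rule exI[of _ A], simp)+
  then show "\<xi> (Suc n) \<in> measurable (history M \<xi> \<eta> (Suc n)) (count_space UNIV)"
    "\<eta> (Suc n) \<in> measurable (history M \<xi> \<eta> (Suc n)) (count_space UNIV)"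
    by (auto simp: measurable_def sets_history intro!: sigma_sets.Basic)
qed

text \<open>The model prescribes recursions for \<open>Y1\<close> and for the total, not for
  \<open>Y2\<close>, so the simultaneous induction runs over these two.\<close>

lemma counts_measurable_history:
  "Y1 n \<in> measurable (history M \<xi> \<eta> n) (count_space UNIV)"
  "total_balls Y1 Y2 n \<in> measurable (history M \<xi> \<eta> n) (count_space UNIV)"
proof (induction n)
  case 0
  have "Y1 0 \<in> measurable (history M \<xi> \<eta> 0) (count_space UNIV) \<longleftrightarrow>
      (\<lambda>_. y1) \<in> measurable (history M \<xi> \<eta> 0) (count_space UNIV)"
    by (rule measurable_cong) (simp add: initial)
  moreover have "total_balls Y1 Y2 0 \<in> measurable (history M \<xi> \<eta> 0) (count_space UNIV) \<longleftrightarrow>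
      (\<lambda>_. y1 + y2) \<in> measurable (history M \<xi> \<eta> 0) (count_space UNIV)"
    by (rule measurable_cong) (simp add: initial total_balls_def)
  ultimately show "Y1 0 \<in> measurable (history M \<xi> \<eta> 0) (count_space UNIV)"
    "total_balls Y1 Y2 0 \<in> measurable (history M \<xi> \<eta> 0) (count_space UNIV)" by auto
next
  case (Suc n)
  note step_measurable_history[of n, measurable]
  note [measurable] = measurable_from_subalg[OF subalgebra_history_Suc Suc(1)]
    measurable_from_subalg[OF subalgebra_history_Suc Suc(2)]
  show "Y1 (Suc n) \<in> measurable (history M \<xi> \<eta> (Suc n)) (count_space UNIV)"
    by (subst measurable_cong[OF step_Y1]) (simp, measurable)
  show "total_balls Y1 Y2 (Suc n) \<in> measurable (history M \<xi> \<eta> (Suc n)) (count_space UNIV)"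
    by (subst measurable_cong[OF step_total]) (simp, measurable)
qed

section \<open>Total and colour difference as real processes, with pathwise bounds\<close>

definition balls :: "nat \<Rightarrow> 'a \<Rightarrow> real" where
  "balls n \<omega> = real (total_balls Y1 Y2 n \<omega>)"

text \<open>This is \<open>Y1 - Y2\<close>, written through the total because the total has a
  recursion, and in the reals because subtraction of naturals truncates.\<close>

definition imbalance :: "nat \<Rightarrow> 'a \<Rightarrow> real" where
  "imbalance n \<omega> = 2 * real (Y1 n \<omega>) - balls n \<omega>"

text \<open>A crude bound for the change of both \<open>balls\<close> and \<open>imbalance\<close>
  in one draw.\<close>

abbreviation maxstep :: real where
  "maxstep \<equiv> real a + real b + real c"

lemma balls_measurable_history: "balls n \<in> borel_measurable (history M \<xi> \<eta> n)"
proof -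
  note counts_measurable_history[of n, measurable]
  show ?thesis unfolding balls_def by measurable
qed

lemma imbalance_measurable_history: "imbalance n \<in> borel_measurable (history M \<xi> \<eta> n)"
proof -
  note counts_measurable_history[of n, measurable] balls_measurable_history[of n, measurable]
  show ?thesis unfolding imbalance_def by measurable
qed

lemma balls_bounds:
  assumes "\<omega> \<in> space M"
  shows "0 < balls n \<omega>" "balls n \<omega> \<le> real (y1 + y2) + maxstep * real n"
proof (induction n)
  case 0
  show "0 < balls 0 \<omega>" using assms initial_nonempty by (simp add: balls_def total_balls_def initial flip: of_nat_add)
  show "balls 0 \<omega> \<le> real (y1 + y2) + maxstep * real 0"
    using assms by (simp add: balls_def total_balls_def initial)
next
  case (Suc n)
  show "0 < balls (Suc n) \<omega>" "balls (Suc n) \<omega> \<le> real (y1 + y2) + maxstep * real (Suc n)"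
    using Suc by (auto simp: balls_def step_total[OF assms] algebra_simps of_bool_def)
qed

lemma imbalance_le_balls: "\<bar>imbalance n \<omega>\<bar> \<le> balls n \<omega>"
  by (simp add: imbalance_def balls_def total_balls_def)

lemma proportion_eq:
  assumes "\<omega> \<in> space M"
  shows "proportion Y1 Y2 n \<omega> = (1 + imbalance n \<omega> / balls n \<omega>) / 2"
  using balls_bounds(1)[OF assms, of n]
  by (simp add: proportion_def imbalance_def balls_def field_simps)

section \<open>Law of a single draw given the past\<close>

definition rule_event :: "nat \<Rightarrow> nat \<Rightarrow> 'a set" where
  "rule_event i n = {\<omega> \<in> space M. \<xi> (Suc n) \<omega> = i}"

definition rule_type1_event :: "nat \<Rightarrow> nat \<Rightarrow> 'a set" where
  "rule_type1_event i n = {\<omega> \<in> space M. \<xi> (Suc n) \<omega> = i \<and> \<eta> (Suc n) \<omega> = 1}"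

lemma rule_events_measurable [measurable]:
  "rule_event i n \<in> sets M" "rule_type1_event i n \<in> sets M"
proof -
  note [measurable] = eta_measurable[of n] xi_measurable[of "Suc n", simplified]
  show "rule_event i n \<in> sets M" "rule_type1_event i n \<in> sets M"
    unfolding rule_event_def rule_type1_event_def by measurable
qed

text \<open>Values of \<open>\<xi>\<close> other than 0 and 1 have probability zero but are not
  excluded pointwise. Both indicators then vanish and nothing is added, so the identity holds on all
  of \<open>space M\<close>.\<close>

lemma balls_Suc:
  assumes "\<omega> \<in> space M"
  shows "balls (Suc n) \<omega> - balls n \<omega> =
    (real a + real b) * indicator (rule_event 1 n) \<omega> + real c * indicator (rule_event 0 n) \<omega>"
  using assms step_total[OF assms, of n]
  by (auto simp: balls_def rule_event_def indicator_def)

text \<open>Twice the indicator of rule and type 1 minus the indicator of the rule is the sign of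
  the drawn colour while that rule is applied. The Friedman rule moves the difference by
  \<open>a - b\<close> times this sign, the Polya rule by \<open>c\<close> times it.\<close>

lemma imbalance_Suc:
  assumes "\<omega> \<in> space M"
  shows "imbalance (Suc n) \<omega> - imbalance n \<omega> =
    (real a - real b) * (2 * indicator (rule_type1_event 1 n) \<omega> - indicator (rule_event 1 n) \<omega>)
    + real c * (2 * indicator (rule_type1_event 0 n) \<omega> - indicator (rule_event 0 n) \<omega>)"
  using assms step_total[OF assms, of n] step_Y1[OF assms, of n] eta_range[OF assms, of n]
  by (auto simp: imbalance_def balls_def rule_event_def rule_type1_event_def indicator_def)

lemma increment_bounds:
  assumes "\<omega> \<in> space M"
  shows "\<bar>balls (Suc n) \<omega> - balls n \<omega>\<bar> \<le> maxstep"
    "\<bar>imbalance (Suc n) \<omega> - imbalance n \<omega>\<bar> \<le> maxstep"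
  unfolding balls_Suc[OF assms] imbalance_Suc[OF assms]
  by (auto simp: rule_event_def rule_type1_event_def indicator_def)

text \<open>By independence of \<open>\<xi> (Suc n)\<close> from the past, the constant
  \<open>q\<close> has the integrals over past events that characterise the conditional
  expectation.\<close>

lemma cond_probability_rule:
  assumes "prob (rule_event i n) = q"
  shows "AE \<omega> in M. cond_probability M (history M \<xi> \<eta> n) (rule_event i n) \<omega> = q"
proof -
  interpret H: finite_measure_subalgebra M "history M \<xi> \<eta> n"
    by (rule history_finite_subalgebra)
  have "prob (rule_event i n \<inter> A) = q * prob A" if "A \<in> sets (history M \<xi> \<eta> n)" for A
  proof -
    have "rule_event i n = \<xi> (Suc n) -` {i} \<inter> space M" by (auto simp: rule_event_def)
    then have "rule_event i n \<in> sets (vimage_algebra (space M) (\<xi> (Suc n)) (count_space UNIV))"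
      by (auto intro!: in_vimage_algebra)
    then show ?thesis using indep_setD[OF xi_indep_history _ that] assms by simp
  qed
  then show ?thesis
    unfolding cond_probability_def
    using subalgebra_history[of n]
    by (intro H.real_cond_exp_charact)
      (auto simp: set_lebesgue_integral_def subalgebra_def indicator_inter_arith[symmetric] Int_commute
        intro: integrable_real_indicator emeasure_finite simp: less_top[symmetric])
qed

text \<open>A weight \<open>f\<close> determined by the past lets each indicator be replaced by its
  conditional probability: \<open>q\<close> for the rule, and, by conditional independence,
  \<open>q\<close> times the proportion for rule and colour together.\<close>

lemma expectation_rule:
  assumes q: "prob (rule_event i n) = q"
    and f: "f \<in> borel_measurable (history M \<xi> \<eta> n)"
    and bounded: "\<And>\<omega>. \<omega> \<in> space M \<Longrightarrow> \<bar>f \<omega>\<bar> \<le> K"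
  shows "expectation (\<lambda>\<omega>. f \<omega> * indicator (rule_event i n) \<omega>) = q * expectation f"
    and "expectation (\<lambda>\<omega>. f \<omega> * indicator (rule_type1_event i n) \<omega>)
      = q * expectation (\<lambda>\<omega>. f \<omega> * proportion Y1 Y2 n \<omega>)"
proof -
  interpret H: finite_measure_subalgebra M "history M \<xi> \<eta> n"
    by (rule history_finite_subalgebra)
  have fM [measurable]: "f \<in> borel_measurable M"
    by (rule measurable_from_subalg[OF subalgebra_history f])
  have int: "integrable M (\<lambda>\<omega>. f \<omega> * indicator A \<omega>)" if "A \<in> sets M" for A
    using that bounded
    by (intro integrable_const_bound[where B = K] AE_I2)
      (auto simp: indicator_def intro: order_trans[OF abs_ge_zero bounded])
  have "expectation (\<lambda>\<omega>. f \<omega> * indicator (rule_event i n) \<omega>)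
      = expectation (\<lambda>\<omega>. f \<omega> * cond_probability M (history M \<xi> \<eta> n) (rule_event i n) \<omega>)"
    unfolding cond_probability_def
    by (rule H.real_cond_exp_intg(2)[symmetric]) (auto intro!: int f)
  also have "\<dots> = expectation (\<lambda>\<omega>. f \<omega> * q)"
    using cond_probability_rule[OF q]
    by (intro integral_cong_AE) (auto simp: cond_probability_def)
  finally show "expectation (\<lambda>\<omega>. f \<omega> * indicator (rule_event i n) \<omega>) = q * expectation f"
    by simp
  note counts_measurable_history[of n, measurable]
  have "proportion Y1 Y2 n \<in> borel_measurable (history M \<xi> \<eta> n)"
    unfolding proportion_def by measurable
  note [measurable] = measurable_from_subalg[OF subalgebra_history this]
  have "AE \<omega> in M. cond_probability M (history M \<xi> \<eta> n) (rule_type1_event i n) \<omega> =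
      cond_probability M (history M \<xi> \<eta> n) (rule_event i n) \<omega> *
      cond_probability M (history M \<xi> \<eta> n) {\<omega> \<in> space M. \<eta> (Suc n) \<omega> = 1} \<omega>"
    using xi_eta_cond_indep[of n, unfolded cond_indep_given_def, rule_format, of "{i}" "{1}"]
    by (simp add: rule_event_def rule_type1_event_def)
  then have ae: "AE \<omega> in M. cond_probability M (history M \<xi> \<eta> n) (rule_type1_event i n) \<omega>
      = q * proportion Y1 Y2 n \<omega>"
    using cond_probability_rule[OF q] eta_cond[of n] by eventually_elim simp
  have "expectation (\<lambda>\<omega>. f \<omega> * indicator (rule_type1_event i n) \<omega>)
      = expectation (\<lambda>\<omega>. f \<omega> * cond_probability M (history M \<xi> \<eta> n) (rule_type1_event i n) \<omega>)"
    unfolding cond_probability_def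
    by (rule H.real_cond_exp_intg(2)[symmetric]) (auto intro!: int f)
  also have "\<dots> = expectation (\<lambda>\<omega>. q * (f \<omega> * proportion Y1 Y2 n \<omega>))"
    using ae by (intro integral_cong_AE) (auto simp: cond_probability_def)
  finally show "expectation (\<lambda>\<omega>. f \<omega> * indicator (rule_type1_event i n) \<omega>)
      = q * expectation (\<lambda>\<omega>. f \<omega> * proportion Y1 Y2 n \<omega>)" by simp
qed

lemma prob_rule_event: "prob (rule_event 1 n) = p" "prob (rule_event 0 n) = 1 - p"
  using xi_distr[of n] by (simp_all add: rule_event_def)

text \<open>\<open>imbalance_rate\<close> and \<open>balls_rate\<close> are the \<rho> and m of the
  introductory text.\<close>

definition imbalance_rate :: real where
  "imbalance_rate = p * (real a - real b) + (1 - p) * real c"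

definition balls_rate :: real where
  "balls_rate = p * (real a + real b) + (1 - p) * real c"

text \<open>The two gaps are \<open>2 * p * b\<close> and \<open>2 * (p * a + (1 - p) * c)\<close>.
  The first shows that the pull towards balance comes from the \<open>b\<close> balls of the
  opposite colour.\<close>

lemma rates: "\<bar>imbalance_rate\<bar> < balls_rate" "balls_rate \<le> maxstep"
proof -
  have "0 < p * real a" "0 < p * real b" "0 < (1 - p) * real c"
    using positive p_range by auto
  then show "\<bar>imbalance_rate\<bar> < balls_rate"
    by (simp add: imbalance_rate_def balls_rate_def algebra_simps abs_less_iff)
  have "p * (real a + real b) \<le> 1 * (real a + real b)" "(1 - p) * real c \<le> 1 * real c"
    using p_range by (intro mult_right_mono; simp)+
  then show "balls_rate \<le> maxstep" by (simp add: balls_rate_def)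
qed

lemma balls_imbalance_measurable [measurable]:
  "balls n \<in> borel_measurable M" "imbalance n \<in> borel_measurable M"
  using measurable_from_subalg[OF subalgebra_history] balls_measurable_history imbalance_measurable_history
  by blast+

lemma integrable_bounded:
  fixes f :: "'a \<Rightarrow> real"
  assumes "f \<in> borel_measurable M" and "\<And>\<omega>. \<omega> \<in> space M \<Longrightarrow> \<bar>f \<omega>\<bar> \<le> K"
  shows "integrable M f"
  using assms by (intro integrable_const_bound[where B = K] AE_I2) auto

lemma integrable_mult_bounded:
  fixes f g :: "'a \<Rightarrow> real"
  assumes [measurable]: "f \<in> borel_measurable M" "g \<in> borel_measurable M"
    and f: "\<And>\<omega>. \<omega> \<in> space M \<Longrightarrow> \<bar>f \<omega>\<bar> \<le> K" and g: "\<And>\<omega>. \<omega> \<in> space M \<Longrightarrow> \<bar>g \<omega>\<bar> \<le> L"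
  shows "integrable M (\<lambda>\<omega>. f \<omega> * g \<omega>)"
proof (rule integrable_bounded)
  fix \<omega> assume \<omega>: "\<omega> \<in> space M"
  have "0 \<le> K" using f[OF \<omega>] by linarith
  then show "\<bar>f \<omega> * g \<omega>\<bar> \<le> K * L"
    unfolding abs_mult using f[OF \<omega>] g[OF \<omega>] by (intro mult_mono) auto
qed measurable

lemma imbalance_ratio_le_1: "\<omega> \<in> space M \<Longrightarrow> \<bar>imbalance n \<omega> / balls n \<omega>\<bar> \<le> 1"
  using balls_bounds(1)[of \<omega> n] imbalance_le_balls[of n \<omega>] by (simp add: pos_divide_le_eq)

text \<open>Type 1 is drawn with conditional probability
  \<open>(1 + imbalance n / balls n) / 2\<close>, so the colour sign has conditional mean
  \<open>imbalance n / balls n\<close>; averaging over the rules yields the two rates.\<close>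

lemma expectation_increment:
  assumes f: "f \<in> borel_measurable (history M \<xi> \<eta> n)"
    and bounded: "\<And>\<omega>. \<omega> \<in> space M \<Longrightarrow> \<bar>f \<omega>\<bar> \<le> K"
  shows "expectation (\<lambda>\<omega>. f \<omega> * (imbalance (Suc n) \<omega> - imbalance n \<omega>))
      = imbalance_rate * expectation (\<lambda>\<omega>. f \<omega> * (imbalance n \<omega> / balls n \<omega>))"
    and "expectation (\<lambda>\<omega>. f \<omega> * (balls (Suc n) \<omega> - balls n \<omega>)) = balls_rate * expectation f"
proof -
  have [measurable]: "f \<in> borel_measurable M"
    by (rule measurable_from_subalg[OF subalgebra_history f])
  note int [simp] = integrable_mult_bounded[of f _ K 1, OF _ _ bounded]
  have intf [simp]: "integrable M f"
    using int[of "\<lambda>_. 1"] by simp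
  have ind [simp]: "integrable M (\<lambda>\<omega>. f \<omega> * indicator A \<omega>)" if "A \<in> sets M" for A
    using that by (intro int) (auto simp: indicator_def)
  have frac [simp]: "integrable M (\<lambda>\<omega>. f \<omega> * (imbalance n \<omega> / balls n \<omega>))"
    by (intro int imbalance_ratio_le_1) measurable
  have half: "expectation (\<lambda>\<omega>. f \<omega> * proportion Y1 Y2 n \<omega>) =
      (expectation f + expectation (\<lambda>\<omega>. f \<omega> * (imbalance n \<omega> / balls n \<omega>))) / 2"
  proof -
    have "expectation (\<lambda>\<omega>. f \<omega> * proportion Y1 Y2 n \<omega>)
        = expectation (\<lambda>\<omega>. (f \<omega> + f \<omega> * (imbalance n \<omega> / balls n \<omega>)) / 2)"
      by (intro Bochner_Integration.integral_cong refl) (simp add: proportion_eq field_simps)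
    then show ?thesis by (simp del: times_divide_eq_right)
  qed
  note E = expectation_rule[OF prob_rule_event(1) f bounded] expectation_rule[OF prob_rule_event(2) f bounded]
  have "expectation (\<lambda>\<omega>. f \<omega> * (imbalance (Suc n) \<omega> - imbalance n \<omega>)) = expectation (\<lambda>\<omega>.
      (real a - real b) * (2 * (f \<omega> * indicator (rule_type1_event 1 n) \<omega>) - f \<omega> * indicator (rule_event 1 n) \<omega>)
      + real c * (2 * (f \<omega> * indicator (rule_type1_event 0 n) \<omega>) - f \<omega> * indicator (rule_event 0 n) \<omega>))"
    by (intro Bochner_Integration.integral_cong refl) (simp add: imbalance_Suc algebra_simps)
  also have "\<dots> = imbalance_rate * expectation (\<lambda>\<omega>. f \<omega> * (imbalance n \<omega> / balls n \<omega>))"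
    by (simp add: E half imbalance_rate_def del: One_nat_def) (simp add: field_simps)
  finally show "expectation (\<lambda>\<omega>. f \<omega> * (imbalance (Suc n) \<omega> - imbalance n \<omega>))
      = imbalance_rate * expectation (\<lambda>\<omega>. f \<omega> * (imbalance n \<omega> / balls n \<omega>))" .
  have "expectation (\<lambda>\<omega>. f \<omega> * (balls (Suc n) \<omega> - balls n \<omega>)) = expectation (\<lambda>\<omega>.
      (real a + real b) * (f \<omega> * indicator (rule_event 1 n) \<omega>)
      + real c * (f \<omega> * indicator (rule_event 0 n) \<omega>))"
    by (intro Bochner_Integration.integral_cong refl) (simp add: balls_Suc algebra_simps)
  also have "\<dots> = balls_rate * expectation f"
    by (simp add: E balls_rate_def del: One_nat_def) (simp add: field_simps)
  finally show "expectation (\<lambda>\<omega>. f \<omega> * (balls (Suc n) \<omega> - balls n \<omega>)) = balls_rate * expectation f" .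
qed

section \<open>Exponential moments of \<open>s * imbalance - \<beta> * balls\<close>, with
  \<open>s\<close> selecting the side of the deviation\<close>

definition lyapunov :: "real \<Rightarrow> real \<Rightarrow> real \<Rightarrow> nat \<Rightarrow> 'a \<Rightarrow> real" where
  "lyapunov l s \<beta> n \<omega> = exp (l * (s * imbalance n \<omega> - \<beta> * balls n \<omega>))"

lemma lyapunov_measurable [measurable]: "lyapunov l s \<beta> n \<in> borel_measurable M"
  unfolding lyapunov_def by measurable

text \<open>A priori growth from \<open>\<bar>imbalance\<bar> \<le> balls\<close>; it is the only
  control available on the exceptional event.\<close>

lemma lyapunov_le:
  assumes "\<omega> \<in> space M" "\<bar>s\<bar> = 1" "0 \<le> \<beta>" "0 \<le> l"
  shows "lyapunov l s \<beta> n \<omega> \<le> exp (l * (real (y1 + y2) + maxstep * real n))"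
proof -
  have "s * imbalance n \<omega> \<le> \<bar>s * imbalance n \<omega>\<bar>" by (rule abs_ge_self)
  also have "\<dots> \<le> real (y1 + y2) + maxstep * real n"
    using assms imbalance_le_balls[of n \<omega>] balls_bounds(2)[of \<omega> n] by (simp add: abs_mult)
  finally have "s * imbalance n \<omega> - \<beta> * balls n \<omega> \<le> real (y1 + y2) + maxstep * real n"
    using mult_nonneg_nonneg[OF assms(3) less_imp_le[OF balls_bounds(1)[OF assms(1), of n]]] by linarith
  then show ?thesis
    using assms(4) unfolding lyapunov_def by (simp add: mult_left_mono)
qed

lemma lyapunov_integrable:
  assumes "\<bar>s\<bar> = 1" "0 \<le> \<beta>" "0 \<le> l"
  shows "integrable M (lyapunov l s \<beta> n)"
  using lyapunov_le[OF _ assms, of _ n]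
  by (intro integrable_bounded) (auto simp: lyapunov_def)

definition unbalanced :: "real \<Rightarrow> nat \<Rightarrow> 'a set" where
  "unbalanced \<delta> n = {\<omega> \<in> space M. \<delta> * balls n \<omega> < \<bar>imbalance n \<omega>\<bar>}"

lemma unbalanced_measurable [measurable]: "unbalanced \<delta> n \<in> sets M"
  unfolding unbalanced_def by measurable

text \<open>On the event \<open>\<bar>imbalance\<bar> \<le> \<delta> * balls\<close> the drift of
  the exponent is at most \<open>- l * g\<close>, and the quadratic remainder of the exponential
  costs at most half of that. The complement contributes the a priori bound times its
  probability.\<close>

lemma expectation_lyapunov_Suc:
  assumes s: "\<bar>s\<bar> = 1" and \<beta>: "0 \<le> \<beta>" "\<beta> \<le> 1"
    and l: "0 < l" "2 * l * maxstep \<le> 1"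
    and g: "g = \<beta> * balls_rate - \<bar>imbalance_rate\<bar> * \<delta>" "(2 * l * maxstep)\<^sup>2 \<le> l * g / 2" "l * g \<le> 1"
  shows "expectation (lyapunov l s \<beta> (Suc n)) \<le> (1 - l * g / 2) * expectation (lyapunov l s \<beta> n)
    + exp (l * (real (y1 + y2) + maxstep * real (Suc n))) * prob (unbalanced \<delta> n)"
proof -
  define W where "W \<omega> = s * (imbalance (Suc n) \<omega> - imbalance n \<omega>) - \<beta> * (balls (Suc n) \<omega> - balls n \<omega>)" for \<omega>
  \<comment> \<open>The truncation to the good event depends only on the first \<open>n\<close>
    steps, so \<open>f\<close> can serve as weight in \<open>expectation_increment\<close>.\<close>
  define f where "f \<omega> = lyapunov l s \<beta> n \<omega> * (if \<bar>imbalance n \<omega>\<bar> \<le> \<delta> * balls n \<omega> then 1 else 0)" for \<omega>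
  define E where "E = exp (l * (real (y1 + y2) + maxstep * real (Suc n)))"
  define F where "F = exp (l * (real (y1 + y2) + maxstep * real n))"
  have f_bounds: "0 \<le> f \<omega>" "f \<omega> \<le> lyapunov l s \<beta> n \<omega>" for \<omega>
    by (auto simp: f_def lyapunov_def)
  have fF: "\<bar>f \<omega>\<bar> \<le> F" if "\<omega> \<in> space M" for \<omega>
    using f_bounds[of \<omega>] lyapunov_le[OF that s \<beta>(1), of l n] l by (simp add: F_def)
  have fH: "f \<in> borel_measurable (history M \<xi> \<eta> n)"
  proof -
    note [measurable] = balls_measurable_history[of n] imbalance_measurable_history[of n]
    show ?thesis unfolding f_def lyapunov_def by measurable
  qed
  note [measurable] = measurable_from_subalg[OF subalgebra_history fH]
  have W: "\<bar>W \<omega>\<bar> \<le> 2 * maxstep" if "\<omega> \<in> space M" for \<omega>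
  proof -
    have "\<bar>s * (imbalance (Suc n) \<omega> - imbalance n \<omega>)\<bar> \<le> maxstep"
      using increment_bounds(2)[OF that, of n] s by (simp add: abs_mult)
    moreover have "\<bar>\<beta> * (balls (Suc n) \<omega> - balls n \<omega>)\<bar> \<le> 1 * maxstep"
      unfolding abs_mult using increment_bounds(1)[OF that, of n] \<beta> by (intro mult_mono) auto
    moreover have "\<bar>x - y\<bar> \<le> 2 * k" if "\<bar>x\<bar> \<le> k" "\<bar>y\<bar> \<le> 1 * k" for x y k :: real
      using that by linarith
    ultimately show ?thesis unfolding W_def by blast
  qed
  have pointwise: "lyapunov l s \<beta> (Suc n) \<omega>
      \<le> f \<omega> * (1 + l * W \<omega> + (2 * l * maxstep)\<^sup>2) + E * indicator (unbalanced \<delta> n) \<omega>"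
    if \<omega>: "\<omega> \<in> space M" for \<omega>
  proof (cases "\<bar>imbalance n \<omega>\<bar> \<le> \<delta> * balls n \<omega>")
    case True
    have lW: "\<bar>l * W \<omega>\<bar> \<le> 2 * l * maxstep"
      using mult_left_mono[OF W[OF \<omega>], of l] l by (simp add: abs_mult mult_ac)
    then have "exp (l * W \<omega>) \<le> 1 + l * W \<omega> + (l * W \<omega>)\<^sup>2"
      using l by (intro exp_le_quadratic) linarith
    also have "(l * W \<omega>)\<^sup>2 \<le> (2 * l * maxstep)\<^sup>2"
      using power_mono[OF lW, of 2] by simp
    finally have "exp (l * W \<omega>) \<le> 1 + l * W \<omega> + (2 * l * maxstep)\<^sup>2" by simp
    moreover have "lyapunov l s \<beta> (Suc n) \<omega> = f \<omega> * exp (l * W \<omega>)"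
      using True by (simp add: f_def lyapunov_def W_def flip: exp_add) (simp add: algebra_simps)
    ultimately show ?thesis
      using mult_left_mono[OF _ f_bounds(1)] True \<omega> by (simp add: unbalanced_def)
  next
    case False
    then show ?thesis
      using \<omega> lyapunov_le[OF \<omega> s \<beta>(1), of l "Suc n"] l by (simp add: unbalanced_def f_def E_def)
  qed
  note int [simp] = integrable_mult_bounded[of f _ F, OF _ _ fF]
  have intf [simp]: "integrable M f"
    using int[of "\<lambda>_. 1" 1] by simp
  have [simp]: "integrable M (\<lambda>\<omega>. f \<omega> * (imbalance (Suc n) \<omega> - imbalance n \<omega>))"
    "integrable M (\<lambda>\<omega>. f \<omega> * (balls (Suc n) \<omega> - balls n \<omega>))"
    using increment_bounds[of _ n] by (auto intro!: int)
  have [simp]: "integrable M (\<lambda>\<omega>. f \<omega> * (imbalance n \<omega> / balls n \<omega>))"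
    by (intro int[of _ 1] imbalance_ratio_le_1) measurable
  have "expectation (lyapunov l s \<beta> (Suc n)) \<le>
      expectation (\<lambda>\<omega>. f \<omega> * (1 + l * W \<omega> + (2 * l * maxstep)\<^sup>2) + E * indicator (unbalanced \<delta> n) \<omega>)"
  proof (rule integral_mono)
    show "integrable M (lyapunov l s \<beta> (Suc n))"
      using lyapunov_integrable[OF s \<beta>(1)] l by simp
    have [measurable]: "W \<in> borel_measurable M" unfolding W_def by measurable
    have "integrable M (\<lambda>\<omega>. f \<omega> * (1 + l * W \<omega> + (2 * l * maxstep)\<^sup>2))"
    proof (rule int)
      fix \<omega> assume "\<omega> \<in> space M"
      then have "\<bar>l * W \<omega>\<bar> \<le> l * (2 * maxstep)"
        unfolding abs_mult using W l by (intro mult_mono) auto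
      then show "\<bar>1 + l * W \<omega> + (2 * l * maxstep)\<^sup>2\<bar> \<le> 1 + l * (2 * maxstep) + (2 * l * maxstep)\<^sup>2"
        by (smt (verit) zero_le_power2)
    qed measurable
    then show "integrable M (\<lambda>\<omega>. f \<omega> * (1 + l * W \<omega> + (2 * l * maxstep)\<^sup>2) + E * indicator (unbalanced \<delta> n) \<omega>)"
      by (auto simp: emeasure_finite less_top[symmetric])
  qed (rule pointwise)
  also have "\<dots> = expectation (\<lambda>\<omega>. (1 + (2 * l * maxstep)\<^sup>2) * f \<omega>
      + l * s * (f \<omega> * (imbalance (Suc n) \<omega> - imbalance n \<omega>))
      - l * \<beta> * (f \<omega> * (balls (Suc n) \<omega> - balls n \<omega>)) + E * indicator (unbalanced \<delta> n) \<omega>)"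
    by (intro Bochner_Integration.integral_cong refl) (simp add: W_def algebra_simps)
  also have "\<dots> = (1 + (2 * l * maxstep)\<^sup>2) * expectation f
      + l * s * (imbalance_rate * expectation (\<lambda>\<omega>. f \<omega> * (imbalance n \<omega> / balls n \<omega>)))
      - l * \<beta> * (balls_rate * expectation f) + E * prob (unbalanced \<delta> n)"
    by (simp add: expectation_increment[OF fH fF] emeasure_finite less_top[symmetric])
  also have "\<dots> \<le> (1 - l * g / 2) * expectation f + E * prob (unbalanced \<delta> n)"
  proof -
    have "\<bar>expectation (\<lambda>\<omega>. f \<omega> * (imbalance n \<omega> / balls n \<omega>))\<bar>
        \<le> expectation (\<lambda>\<omega>. \<bar>f \<omega> * (imbalance n \<omega> / balls n \<omega>)\<bar>)"
      by (rule integral_abs_bound)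
    also have "\<dots> \<le> expectation (\<lambda>\<omega>. f \<omega> * \<delta>)"
    proof (rule integral_mono)
      fix \<omega> assume \<omega>: "\<omega> \<in> space M"
      show "\<bar>f \<omega> * (imbalance n \<omega> / balls n \<omega>)\<bar> \<le> f \<omega> * \<delta>"
        using balls_bounds(1)[OF \<omega>, of n] f_bounds(1)[of \<omega>]
        by (auto simp: f_def abs_mult pos_divide_le_eq lyapunov_def intro!: mult_left_mono)
    qed (auto intro!: integrable_abs simp del: times_divide_eq_right)
    \<comment> \<open>Taking absolute values treats both signs \<open>s\<close> and either sign of
      \<open>imbalance_rate\<close> at once.\<close>
    finally have "\<bar>s * imbalance_rate * expectation (\<lambda>\<omega>. f \<omega> * (imbalance n \<omega> / balls n \<omega>))\<bar>
        \<le> \<bar>imbalance_rate\<bar> * (\<delta> * expectation f)"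
      using s by (simp add: abs_mult mult.commute[of _ \<delta>] mult_left_mono del: times_divide_eq_right)
    then have "s * imbalance_rate * expectation (\<lambda>\<omega>. f \<omega> * (imbalance n \<omega> / balls n \<omega>))
        \<le> \<bar>imbalance_rate\<bar> * (\<delta> * expectation f)" by linarith
    then have "l * (s * imbalance_rate * expectation (\<lambda>\<omega>. f \<omega> * (imbalance n \<omega> / balls n \<omega>)))
        \<le> l * (\<bar>imbalance_rate\<bar> * (\<delta> * expectation f))"
      using l by (intro mult_left_mono) auto
    moreover have "(2 * l * maxstep)\<^sup>2 * expectation f \<le> l * g / 2 * expectation f"
      using g(2) f_bounds by (intro mult_right_mono) auto
    moreover have "(1 - l * g / 2) * expectation f = expectation f + l * g / 2 * expectation f
        + l * (\<bar>imbalance_rate\<bar> * (\<delta> * expectation f)) - l * \<beta> * (balls_rate * expectation f)"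
      by (simp add: g(1) field_simps)
    ultimately show ?thesis by (simp only: distrib_right mult_1_left mult.assoc)
  qed
  also have "(1 - l * g / 2) * expectation f \<le> (1 - l * g / 2) * expectation (lyapunov l s \<beta> n)"
    using g(3) f_bounds lyapunov_integrable[OF s \<beta>(1), of l n] l
    by (intro mult_left_mono integral_mono) auto
  finally show ?thesis by (simp add: E_def)
qed

text \<open>An arbitrary prefactor and all \<open>n\<close> make the property stable under the
  recursion; the factor 2 and the restriction to large \<open>n\<close> enter only at the
  end.\<close>

definition concentrated :: "real \<Rightarrow> bool" where
  "concentrated \<delta> \<longleftrightarrow> (\<exists>C \<kappa>. 0 \<le> C \<and> 0 < \<kappa> \<and> (\<forall>n. prob (unbalanced \<delta> n) \<le> C * exp (- \<kappa> * real n)))"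

text \<open>With \<open>l * maxstep \<le> \<kappa> / 2\<close>, the a priori growth uses up at most
  half of the decay rate \<open>\<kappa>\<close> of the exceptional event. The remaining term decays
  at least like \<open>r ^ n\<close>, as \<open>geometric_recursion_bound\<close> requires.\<close>

lemma expectation_lyapunov_decay:
  assumes s: "\<bar>s\<bar> = 1" and \<beta>: "0 \<le> \<beta>" "\<beta> \<le> 1"
    and l: "0 < l" "2 * l * maxstep \<le> 1"
    and g: "g = \<beta> * balls_rate - \<bar>imbalance_rate\<bar> * \<delta>" "(2 * l * maxstep)\<^sup>2 \<le> l * g / 2" "l * g \<le> 1"
    and C: "0 \<le> C" "\<And>n. prob (unbalanced \<delta> n) \<le> C * exp (- \<kappa> * real n)"
    and \<kappa>: "l * maxstep \<le> \<kappa> / 2"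
    and r: "r = max (1 - l * g / 2) (exp (- (\<kappa> / 2)))" "r < R"
  obtains D where "0 \<le> D" "\<And>n. expectation (lyapunov l s \<beta> n) \<le> D * R ^ n"
proof (rule geometric_recursion_bound)
  have r0: "0 < r" by (simp add: r(1) less_max_iff_disj)
  show "0 < r" "r < R" by (rule r0) (rule r(2))
  \<comment> \<open>The extra \<open>maxstep\<close> comes from the a priori bound being taken at
    time \<open>Suc n\<close>.\<close>
  define K where "K = exp (l * (real (y1 + y2) + maxstep)) * C"
  show "0 \<le> K" using C(1) by (simp add: K_def)
  show "expectation (lyapunov l s \<beta> (Suc n)) \<le> r * expectation (lyapunov l s \<beta> n) + K * r ^ n" for n
  proof -
    have "exp (l * (real (y1 + y2) + maxstep * real (Suc n))) * prob (unbalanced \<delta> n)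
        \<le> exp (l * (real (y1 + y2) + maxstep * real (Suc n))) * (C * exp (- \<kappa> * real n))"
      by (intro mult_left_mono C(2)) simp
    also have "\<dots> = K * exp (real n * (l * maxstep - \<kappa>))"
      by (simp add: K_def exp_add[symmetric] algebra_simps)
    also have "\<dots> \<le> K * exp (real n * (- (\<kappa> / 2)))"
      using \<kappa> \<open>0 \<le> K\<close> by (intro mult_left_mono iffD2[OF exp_le_cancel_iff]) (auto simp del: mult_minus_right)
    also have "\<dots> = K * exp (- (\<kappa> / 2)) ^ n"
      by (simp only: exp_of_nat_mult)
    also have "\<dots> \<le> K * r ^ n"
      using \<open>0 \<le> K\<close> by (intro mult_left_mono power_mono) (auto simp: r(1))
    finally have *: "exp (l * (real (y1 + y2) + maxstep * real (Suc n))) * prob (unbalanced \<delta> n) \<le> K * r ^ n" .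
    have "(1 - l * g / 2) * expectation (lyapunov l s \<beta> n) \<le> r * expectation (lyapunov l s \<beta> n)"
      by (intro mult_right_mono integral_nonneg_AE AE_I2) (auto simp: r(1) lyapunov_def)
    with * expectation_lyapunov_Suc[OF s \<beta> l g, of n] show ?thesis by linarith
  qed
qed (use that in blast)

text \<open>Chernoff bound for both sides: on the event one of the two exponents is
  nonnegative.\<close>

lemma prob_unbalanced_le_lyapunov:
  assumes \<beta>: "0 \<le> \<beta>" and l: "0 \<le> l"
  shows "prob (unbalanced \<beta> n) \<le> expectation (lyapunov l 1 \<beta> n) + expectation (lyapunov l (- 1) \<beta> n)"
proof -
  have int: "integrable M (lyapunov l 1 \<beta> n)" "integrable M (lyapunov l (- 1) \<beta> n)"
    using assms by (auto intro: lyapunov_integrable)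
  have "prob (unbalanced \<beta> n) = expectation (indicator (unbalanced \<beta> n))"
    by simp
  also have "\<dots> \<le> expectation (\<lambda>\<omega>. lyapunov l 1 \<beta> n \<omega> + lyapunov l (- 1) \<beta> n \<omega>)"
  proof (rule integral_mono)
    show "indicator (unbalanced \<beta> n) \<omega> \<le> lyapunov l 1 \<beta> n \<omega> + lyapunov l (- 1) \<beta> n \<omega>" for \<omega>
    proof (cases "\<beta> * balls n \<omega> < \<bar>imbalance n \<omega>\<bar>")
      case True
      then consider "0 \<le> imbalance n \<omega> - \<beta> * balls n \<omega>" | "0 \<le> - imbalance n \<omega> - \<beta> * balls n \<omega>"
        by linarith
      then have "1 \<le> lyapunov l 1 \<beta> n \<omega> \<or> 1 \<le> lyapunov l (- 1) \<beta> n \<omega>"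
        using l by cases (auto simp: lyapunov_def)
      moreover have "0 \<le> lyapunov l 1 \<beta> n \<omega>" "0 \<le> lyapunov l (- 1) \<beta> n \<omega>"
        by (simp_all add: lyapunov_def)
      ultimately show ?thesis by (auto simp: indicator_def)
    next
      case False
      then show ?thesis by (auto simp: unbalanced_def lyapunov_def)
    qed
  qed (use int in \<open>auto simp: emeasure_finite less_top[symmetric]\<close>)
  also have "\<dots> = expectation (lyapunov l 1 \<beta> n) + expectation (lyapunov l (- 1) \<beta> n)"
    using int by simp
  finally show ?thesis .
qed

section \<open>Contraction of the level of concentration, and its iteration\<close>

lemma concentrated_contract:
  assumes conc: "concentrated \<delta>" and \<delta>: "0 < \<delta>" "\<delta> \<le> 1"
    and \<theta>: "\<theta> \<le> 1" "\<bar>imbalance_rate\<bar> < \<theta> * balls_rate"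
  shows "concentrated (\<theta> * \<delta>)"
proof -
  obtain C \<kappa> where C: "0 \<le> C" "\<And>n. prob (unbalanced \<delta> n) \<le> C * exp (- \<kappa> * real n)" and \<kappa>: "0 < \<kappa>"
    using conc by (auto simp: concentrated_def)
  have "0 < balls_rate" using rates(1) by linarith
  moreover have "0 < \<theta> * balls_rate" using \<theta>(2) by linarith
  ultimately have "0 < \<theta>" by (simp add: zero_less_mult_iff)
  define B where "B = maxstep"
  have B: "0 < B" using positive by (simp add: B_def)
  define \<beta> where "\<beta> = \<theta> * \<delta>"
  have \<beta>: "0 \<le> \<beta>" "\<beta> \<le> 1"
    using \<open>0 < \<theta>\<close> \<theta> \<delta> by (auto simp: \<beta>_def mult_le_one)
  define g where "g = \<beta> * balls_rate - \<bar>imbalance_rate\<bar> * \<delta>"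
  have "g = \<delta> * (\<theta> * balls_rate - \<bar>imbalance_rate\<bar>)" by (simp add: g_def \<beta>_def algebra_simps)
  then have g: "0 < g" using \<theta>(2) \<delta>(1) by simp
  \<comment> \<open>In order, the four bounds allow the quadratic expansion, make its remainder at
    most \<open>l * g / 2\<close>, keep the factor \<open>1 - l * g / 2\<close> nonnegative, and let
    the decay rate \<open>\<kappa>\<close> beat the a priori growth.\<close>
  define l where "l = Min {1 / (2 * B), g / (8 * B\<^sup>2), 1 / g, \<kappa> / (2 * B)}"
  have l: "0 < l" using B g \<kappa> by (simp add: l_def)
  have "l \<le> 1 / (2 * B)" "l \<le> g / (8 * B\<^sup>2)" "l \<le> 1 / g" "l \<le> \<kappa> / (2 * B)"
    unfolding l_def by (rule Min_le; simp)+
  then have lB: "2 * l * B \<le> 1" "l * B \<le> \<kappa> / 2" "l * g \<le> 1" and "8 * l * B\<^sup>2 \<le> g"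
    using B g by (auto simp: field_simps)
  from mult_left_mono[OF this(4), of l] have lB2: "(2 * l * B)\<^sup>2 \<le> l * g / 2"
    using l by (simp add: power2_eq_square algebra_simps)
  define r where "r = max (1 - l * g / 2) (exp (- (\<kappa> / 2)))"
  have "0 < r" "r < 1" using l g \<kappa> by (auto simp: r_def less_max_iff_disj)
  \<comment> \<open>The midpoint of \<open>r\<close> and 1 leaves room for the forced recursion and
    still decays, at rate \<open>- ln R\<close>.\<close>
  define R where "R = (1 + r) / 2"
  have R: "r < R" "0 < R" "R < 1" using \<open>0 < r\<close> \<open>r < 1\<close> by (auto simp: R_def)
  note decay = expectation_lyapunov_decay[OF _ \<beta> l lB(1)[unfolded B_def] g_def lB2[unfolded B_def] lB(3)
    C lB(2)[unfolded B_def] r_def R(1)]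
  obtain D1 where D1: "0 \<le> D1" "\<And>n. expectation (lyapunov l 1 \<beta> n) \<le> D1 * R ^ n"
    by (rule decay[of 1]) auto
  obtain D2 where D2: "0 \<le> D2" "\<And>n. expectation (lyapunov l (- 1) \<beta> n) \<le> D2 * R ^ n"
    by (rule decay[of "- 1"]) auto
  have "prob (unbalanced \<beta> n) \<le> (D1 + D2) * exp (- (- ln R) * real n)" for n
  proof -
    have "R ^ n = exp (- (- ln R) * real n)"
      using exp_of_nat_mult[of n "ln R"] R by (simp add: mult.commute)
    then show ?thesis
      using prob_unbalanced_le_lyapunov[OF \<beta>(1), of l n] l D1(2)[of n] D2(2)[of n]
      by (simp add: distrib_right)
  qed
  then show ?thesis
    unfolding concentrated_def \<beta>_def[symmetric] using D1(1) D2(1) R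
    by (intro exI[of _ "D1 + D2"] exI[of _ "- ln R"]) auto
qed

text \<open>The inequality in \<open>unbalanced\<close> is strict, so at level 1 the event is
  empty.\<close>

lemma concentrated_1: "concentrated 1"
proof -
  have "unbalanced 1 n = {}" for n
    using imbalance_le_balls by (auto simp: unbalanced_def not_less)
  then show ?thesis by (auto simp: concentrated_def intro!: exI[of _ 0] exI[of _ 1])
qed

lemma concentrated_mono:
  assumes "concentrated \<delta>" "\<delta> \<le> \<delta>'"
  shows "concentrated \<delta>'"
proof -
  have "unbalanced \<delta>' n \<subseteq> unbalanced \<delta> n" for n
    using mult_right_mono[OF assms(2) less_imp_le[OF balls_bounds(1)], of _ n]
    by (auto simp: unbalanced_def intro: le_less_trans)
  then have "prob (unbalanced \<delta>' n) \<le> prob (unbalanced \<delta> n)" for n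
    by (intro finite_measure_mono) auto
  then show ?thesis
    using assms(1) unfolding concentrated_def by (meson order_trans)
qed

lemma concentrated_pos:
  assumes "0 < \<delta>"
  shows "concentrated \<delta>"
proof -
  have m: "0 < balls_rate" using rates(1) by linarith
  then have "\<bar>imbalance_rate\<bar> / balls_rate < 1" using rates(1) by simp
  \<comment> \<open>The condition on \<open>\<theta>\<close> involves only the two rates, so one
    \<open>\<theta>\<close> serves every level. The constants may worsen at each contraction, but
    finitely many suffice.\<close>
  then obtain \<theta> where \<theta>: "\<bar>imbalance_rate\<bar> / balls_rate < \<theta>" "\<theta> < 1"
    using dense by blast
  have \<theta>0: "0 < \<theta>" using \<theta>(1) m by (smt (verit) divide_nonneg_pos)
  have \<theta>m: "\<bar>imbalance_rate\<bar> < \<theta> * balls_rate" using \<theta>(1) m by (simp add: pos_divide_less_eq)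
  have "concentrated (\<theta> ^ k)" for k
  proof (induction k)
    case 0
    show ?case by (simp add: concentrated_1)
  next
    case (Suc k)
    show ?case
      using concentrated_contract[OF Suc _ _ _ \<theta>m] \<theta>0 \<theta>(2) by (simp add: power_le_one)
  qed
  moreover obtain k where "\<theta> ^ k < \<delta>"
    using real_arch_pow_inv[OF assms \<theta>(2)] by blast
  ultimately show ?thesis by (meson concentrated_mono less_imp_le)
qed

end

section \<open>Transfer to the proportion and normalisation of the prefactor\<close>

theorem corollary3p1:
  fixes M :: "'a measure"
    and a b c :: nat and p :: real and y1 y2 :: nat
    and \<xi> \<eta> Y1 Y2 :: "nat \<Rightarrow> 'a \<Rightarrow> nat"
    and \<epsilon> :: real
  assumes "polya_friedman_urn M a b c p y1 y2 \<xi> \<eta> Y1 Y2"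
    and "\<epsilon> > 0"
  shows "\<exists>\<kappa>>0. \<forall>\<^sub>F n in sequentially.
    measure M {\<omega> \<in> space M. \<bar>proportion Y1 Y2 (Suc n) \<omega> - 1 / 2\<bar> > \<epsilon>}
      \<le> 2 * exp (- \<kappa> * real n)"
proof -
  interpret polya_friedman_urn M a b c p y1 y2 \<xi> \<eta> Y1 Y2 by fact
  \<comment> \<open>The level doubles because the deviation of the proportion from one half is
    \<open>imbalance / (2 * balls)\<close>.\<close>
  have "concentrated (2 * \<epsilon>)" using assms(2) by (intro concentrated_pos) simp
  then obtain C \<kappa> where C: "0 \<le> C" "\<And>n. prob (unbalanced (2 * \<epsilon>) n) \<le> C * exp (- \<kappa> * real n)"
    and \<kappa>: "0 < \<kappa>" by (auto simp: concentrated_def)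
  have event: "{\<omega> \<in> space M. \<bar>proportion Y1 Y2 n \<omega> - 1 / 2\<bar> > \<epsilon>} = unbalanced (2 * \<epsilon>) n" for n
  proof -
    have "\<epsilon> < \<bar>proportion Y1 Y2 n \<omega> - 1 / 2\<bar> \<longleftrightarrow> 2 * \<epsilon> * balls n \<omega> < \<bar>imbalance n \<omega>\<bar>"
      if \<omega>: "\<omega> \<in> space M" for \<omega>
    proof -
      have "\<bar>proportion Y1 Y2 n \<omega> - 1 / 2\<bar> = \<bar>imbalance n \<omega>\<bar> / balls n \<omega> / 2"
        using balls_bounds(1)[OF \<omega>, of n] by (simp add: proportion_eq[OF \<omega>] add_divide_distrib abs_divide)
      then show ?thesis
        using balls_bounds(1)[OF \<omega>, of n] by (simp add: pos_less_divide_eq mult_ac)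
    qed
    then show ?thesis by (auto simp: unbalanced_def)
  qed
  \<comment> \<open>Half of the rate is given up to trade \<open>C\<close> for 2: once
    \<open>n\<close> is at least \<open>C / \<kappa>\<close>, the inequality
    \<open>x \<le> exp x\<close> at \<open>x = \<kappa> / 2 * n\<close> gives
    \<open>C \<le> 2 * exp (\<kappa> / 2 * n)\<close>.\<close>
  have "prob (unbalanced (2 * \<epsilon>) (Suc n)) \<le> 2 * exp (- (\<kappa> / 2) * real n)" if n: "C / \<kappa> \<le> real n" for n
  proof -
    have "C \<le> 2 * (\<kappa> / 2 * real n)" using n \<kappa> by (simp add: pos_divide_le_eq mult.commute)
    also have "\<dots> \<le> 2 * exp (\<kappa> / 2 * real n)"
      using exp_ge_add_one_self[of "\<kappa> / 2 * real n"] by linarith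
    finally have CE: "C \<le> 2 * exp (\<kappa> / 2 * real n)" .
    have "prob (unbalanced (2 * \<epsilon>) (Suc n)) \<le> C * exp (- \<kappa> * real (Suc n))" by (rule C(2))
    also have "\<dots> \<le> C * exp (- \<kappa> * real n)"
      using C(1) \<kappa> by (intro mult_left_mono) auto
    also have "\<dots> \<le> 2 * exp (\<kappa> / 2 * real n) * exp (- \<kappa> * real n)"
      by (intro mult_right_mono CE) simp
    also have "\<dots> = 2 * exp (- (\<kappa> / 2) * real n)"
      by (simp add: mult_exp_exp)
    finally show ?thesis .
  qed
  moreover have "\<forall>\<^sub>F n in sequentially. C / \<kappa> \<le> real n"
    using filterlim_real_sequentially by (simp add: filterlim_at_top)
  ultimately have "\<forall>\<^sub>F n in sequentially. prob (unbalanced (2 * \<epsilon>) (Suc n)) \<le> 2 * exp (- (\<kappa> / 2) * real n)"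
    by (auto elim: eventually_mono)
  then show ?thesis
    using \<kappa> unfolding event by (intro exI[of _ "\<kappa> / 2"]) auto
qed

end
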